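(* Let $G$ be a finite tree with a proper edge coloring $\kappa:E(G)\to[k]$. Then either the centralizer $C_{S_{V(G)}}(\mathfrak{G}_\kappa)$ of the coloring group in $S_{V(G)}$ is trivial, or $|V(G)|=2m$ is even and $\mathfrak{G}_\kappa$ is isomorphic to a subgroup of the type B Coxeter group $B_m$.
   Context: A proper edge coloring of $G$ on $k$ colors is a surjective map $\kappa:E(G)\to[k]$ such that edges sharing a vertex receive different colors. For $a\in[k]$, $\tau_a\in S_{V(G)}$ is the product of the transpositions $(i,j)$ over all edges $\{i,j\}$ colored $a$, and the coloring group $\mathfrak{G}_\kappa\le S_{V(G)}$ is the subgroup generated by $\tau_1,\dots,\tau_k$. $B_m$ is the hyperoctahedral group of signed permutations of $\{\pm1,\dots,\pm m\}$, i.e. the wreath product $C_2\wr S_m$. *)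

theory Defs
  imports "HOL-Algebra.Bij" "HOL-Algebra.FiniteProduct" "HOL-Algebra.Generated_Groups"
    "HOL-Combinatorics.Transposition"
begin

definition simple_graph :: "'a set \<Rightarrow> 'a set set \<Rightarrow> bool" where
  "simple_graph V E \<longleftrightarrow> (\<forall>e\<in>E. e \<subseteq> V \<and> card e = 2)"

definition connected_graph :: "'a set \<Rightarrow> 'a set set \<Rightarrow> bool" where
  "connected_graph V E \<longleftrightarrow>
     V \<noteq> {} \<and> (\<forall>u\<in>V. \<forall>v\<in>V. (u, v) \<in> {(x, y). {x, y} \<in> E}\<^sup>*)"

text \<open>A cycle is given by the list of its vertices, without repetition of the first one at the end.\<close>

definition graph_cycle :: "'a set set \<Rightarrow> 'a list \<Rightarrow> bool" where
  "graph_cycle E vs \<longleftrightarrow> 3 \<le> length vs \<and> distinct vs \<and>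
     (\<forall>i<length vs. {vs ! i, vs ! (Suc i mod length vs)} \<in> E)"

definition finite_tree :: "'a set \<Rightarrow> 'a set set \<Rightarrow> bool" where
  "finite_tree V E \<longleftrightarrow>
     finite V \<and> simple_graph V E \<and> connected_graph V E \<and> (\<nexists>vs. graph_cycle E vs)"

definition proper_edge_coloring :: "'a set set \<Rightarrow> nat \<Rightarrow> ('a set \<Rightarrow> nat) \<Rightarrow> bool" where
  "proper_edge_coloring E k \<kappa> \<longleftrightarrow> \<kappa> ` E = {1..k} \<and>
     (\<forall>e\<in>E. \<forall>f\<in>E. e \<noteq> f \<longrightarrow> e \<inter> f \<noteq> {} \<longrightarrow> \<kappa> e \<noteq> \<kappa> f)"

text \<open>The description determines the permutation because
  \<^term>\<open>transpose i j = transpose j i\<close>. The restriction to \<open>V\<close> is needed since the elements of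
  \<^term>\<open>BijGroup V\<close>, the symmetric group of \<open>V\<close>, are extensional functions.\<close>

definition edge_transposition :: "'a set \<Rightarrow> 'a set \<Rightarrow> 'a \<Rightarrow> 'a" where
  "edge_transposition V e = restrict (THE p. \<exists>i j. e = {i, j} \<and> p = transpose i j) V"

text \<open>The group is not commutative, but the edges of one color are pairwise disjoint, so the
  factors commute and the product does not depend on their order; see \<open>color_perm_eq\<close> below.\<close>

definition color_perm ::
    "'a set \<Rightarrow> 'a set set \<Rightarrow> ('a set \<Rightarrow> nat) \<Rightarrow> nat \<Rightarrow> 'a \<Rightarrow> 'a" where
  "color_perm V E \<kappa> a =
     (\<Otimes>\<^bsub>BijGroup V\<^esub>e\<in>{e \<in> E. \<kappa> e = a}. edge_transposition V e)"

definition coloring_group ::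
    "'a set \<Rightarrow> 'a set set \<Rightarrow> nat \<Rightarrow> ('a set \<Rightarrow> nat) \<Rightarrow> ('a \<Rightarrow> 'a) set" where
  "coloring_group V E k \<kappa> = generate (BijGroup V) (color_perm V E \<kappa> ` {1..k})"

definition centralizer :: "('g, 'b) monoid_scheme \<Rightarrow> 'g set \<Rightarrow> 'g set" where
  "centralizer G H = {g \<in> carrier G. \<forall>h\<in>H. g \<otimes>\<^bsub>G\<^esub> h = h \<otimes>\<^bsub>G\<^esub> g}"

definition signed_perm_group :: "nat \<Rightarrow> (int \<Rightarrow> int) monoid" where
  "signed_perm_group m =
     (let S = {- int m..int m} - {0}
      in (BijGroup S)\<lparr>carrier := {p \<in> carrier (BijGroup S). \<forall>i\<in>S. p (- i) = - p i}\<rparr>)"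

lemma edge_transposition_pair: "edge_transposition V {i, j} = restrict (transpose i j) V"
proof -
  have "(THE p. \<exists>i' j'. {i, j} = {i', j'} \<and> p = transpose i' j') = transpose i j"
    by (rule the_equality) (auto simp: doubleton_eq_iff transpose_commute)
  then show ?thesis by (simp add: edge_transposition_def)
qed

lemma edge_transposition_in_BijGroup:
  assumes "i \<in> V" "j \<in> V"
  shows "edge_transposition V {i, j} \<in> carrier (BijGroup V)"
proof -
  have "bij_betw (transpose i j) V V"
    using assms by (simp add: bij_betw_def)
  then show ?thesis
    by (simp add: edge_transposition_pair BijGroup_def Bij_def)
qed

lemma color_perm_eq:
  assumes "finite V" "simple_graph V E" "proper_edge_coloring E k \<kappa>"
  shows color_perm_in_BijGroup: "color_perm V E \<kappa> a \<in> carrier (BijGroup V)"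
    and color_perm_edge: "{u, v} \<in> E \<Longrightarrow> \<kappa> {u, v} = a \<Longrightarrow> color_perm V E \<kappa> a u = v"
    and color_perm_fixed:
      "u \<in> V \<Longrightarrow> (\<And>v. {u, v} \<in> E \<Longrightarrow> \<kappa> {u, v} \<noteq> a) \<Longrightarrow> color_perm V E \<kappa> a u = u"
proof -
  interpret S: group "BijGroup V" by (rule group_BijGroup)
  let ?S = "BijGroup V" and ?t = "edge_transposition V"
  define C where "C = {e \<in> E. \<kappa> e = a}"
  have finC: "finite C"
    by (rule finite_subset[of _ "Pow V"]) (use assms in \<open>auto simp: C_def simple_graph_def\<close>)
  have pair: "\<exists>i j. e = {i, j} \<and> i \<noteq> j \<and> i \<in> V \<and> j \<in> V" if "e \<in> C" for e
  proof -
    have "e \<subseteq> V" "card e = 2" using that assms(2) by (auto simp: C_def simple_graph_def)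
    then show ?thesis by (auto simp: card_2_iff)
  qed
  have disj: "e \<inter> f = {}" if "e \<in> C" "f \<in> C" "e \<noteq> f" for e f
  proof (rule ccontr)
    assume "e \<inter> f \<noteq> {}"
    moreover have "e \<in> E" "f \<in> E" "\<kappa> e = \<kappa> f" using that by (simp_all add: C_def)
    ultimately show False
      using assms(3) \<open>e \<noteq> f\<close> unfolding proper_edge_coloring_def by metis
  qed
  have t_in: "?t e \<in> carrier ?S" if eC: "e \<in> C" for e
  proof -
    obtain i j where "e = {i, j}" "i \<in> V" "j \<in> V" using pair[OF eC] by blast
    then show ?thesis by (simp only: edge_transposition_in_BijGroup)
  qed
  have mult: "(g \<otimes>\<^bsub>?S\<^esub> h) x = g (h x)"
    if "g \<in> carrier ?S" "h \<in> carrier ?S" "x \<in> V" for g h x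
    using that by (simp add: BijGroup_def compose_eq)
  have ext: "g = h"
    if "g \<in> carrier ?S" "h \<in> carrier ?S" "\<And>x. x \<in> V \<Longrightarrow> g x = h x" for g h
    by (rule extensionalityI[of _ V])
      (use that in \<open>auto simp: BijGroup_def dest: Bij_imp_extensional\<close>)
  have comm: "?t e \<otimes>\<^bsub>?S\<^esub> ?t f = ?t f \<otimes>\<^bsub>?S\<^esub> ?t e" if ef: "e \<in> C" "f \<in> C" for e f
  proof (cases "e = f")
    case False
    obtain i j where e: "e = {i, j}" "i \<in> V" "j \<in> V" using pair[OF ef(1)] by blast
    obtain i' j' where f: "f = {i', j'}" "i' \<in> V" "j' \<in> V" using pair[OF ef(2)] by blast
    show ?thesis
      using disj[OF ef False] e f t_in[OF ef(1)] t_in[OF ef(2)]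
      by (intro ext) (auto simp: mult edge_transposition_pair transpose_def)
  qed simp
  interpret L: LCD C "carrier ?S" "(\<otimes>\<^bsub>?S\<^esub>) \<circ> ?t"
    by unfold_locales (use comm t_in in \<open>auto simp: S.m_assoc[symmetric]\<close>)
  define P where "P F = (\<Otimes>\<^bsub>?S\<^esub>e\<in>F. ?t e)" for F
  have P_empty: "P {} = \<one>\<^bsub>?S\<^esub>"
    by (simp add: P_def finprod_def)
  have P_insert: "P (insert e F) = ?t e \<otimes>\<^bsub>?S\<^esub> P F"
    if "finite F" "e \<notin> F" "e \<in> C" "F \<subseteq> C" for e F
    using that L.foldD_insert[of F e "\<one>\<^bsub>?S\<^esub>"] by (simp add: P_def finprod_def)
  have main: "P F \<in> carrier ?S \<and> (\<forall>u w. {u, w} \<in> F \<longrightarrow> P F u = w) \<and>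
      (\<forall>u\<in>V. (\<forall>w. {u, w} \<notin> F) \<longrightarrow> P F u = u)" if "F \<subseteq> C" for F
    using finite_subset[OF that finC] that
  proof (induction F rule: finite_induct)
    case empty
    then show ?case by (simp add: P_empty, simp add: BijGroup_def)
  next
    case (insert e F)
    then have eC: "e \<in> C" and FC: "F \<subseteq> C" by auto
    note IH = insert.IH[OF FC]
    obtain i j where e: "e = {i, j}" "i \<noteq> j" "i \<in> V" "j \<in> V" using pair[OF eC] by blast
    have PV: "P (insert e F) x = ?t e (P F x)" if "x \<in> V" for x
      using that IH t_in[OF eC] P_insert[OF insert.hyps eC FC] by (simp add: mult)
    have te: "?t e x = transpose i j x" if "x \<in> V" for x
      using that by (simp add: e(1) edge_transposition_pair)
    have notF: "{x, w} \<notin> F" if "x \<in> e" for x w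
      using that disj[OF eC, of "{x, w}"] FC insert.hyps by blast
    have edge: "P (insert e F) u = w" if uw: "{u, w} \<in> insert e F" for u w
    proof (cases "{u, w} \<in> F")
      case True
      then have "w \<notin> e" using notF[of w u] by (auto simp: insert_commute)
      moreover have "u \<in> V" "w \<in> V"
      proof -
        have "{u, w} \<in> E" using True FC by (auto simp: C_def)
        then have "{u, w} \<subseteq> V" using assms(2) unfolding simple_graph_def by blast
        then show "u \<in> V" "w \<in> V" by simp_all
      qed
      ultimately show ?thesis using IH True PV te e by (auto simp: transpose_def)
    next
      case False
      then have uwe: "{u, w} = e" using uw by simp
      then have "u \<in> e" by auto
      with e have "u \<in> V" by auto
      then have "P F u = u" using IH notF[OF \<open>u \<in> e\<close>] by blast
      then show ?thesis using PV[OF \<open>u \<in> V\<close>] te[OF \<open>u \<in> V\<close>] uwe e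
        by (auto simp: doubleton_eq_iff)
    qed
    have fix': "P (insert e F) u = u" if u: "u \<in> V" "\<forall>w. {u, w} \<notin> insert e F" for u
    proof -
      have "u \<noteq> i" "u \<noteq> j" using u(2) e(1) by (auto simp: insert_commute)
      moreover have "P F u = u" using IH u by blast
      ultimately show ?thesis using PV[OF u(1)] te[OF u(1)] by (simp add: transpose_def)
    qed
    have "P (insert e F) \<in> carrier ?S"
      using IH t_in[OF eC] P_insert[OF insert.hyps eC FC] by simp
    with edge fix' show ?case by blast
  qed
  have cp: "color_perm V E \<kappa> a = P C" by (simp add: color_perm_def P_def C_def)
  show "color_perm V E \<kappa> a \<in> carrier ?S"
    unfolding cp using main[of C] by blast
  show "color_perm V E \<kappa> a u = v" if "{u, v} \<in> E" "\<kappa> {u, v} = a"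
    unfolding cp using main[of C] that by (simp add: C_def)
  show "color_perm V E \<kappa> a u = u" if "u \<in> V" "\<And>v. {u, v} \<in> E \<Longrightarrow> \<kappa> {u, v} \<noteq> a"
    unfolding cp using main[of C] that by (simp add: C_def)
qed

end

theory Submission
  imports Defs
begin

text \<open>An element \<open>g\<close> of the centralizer is an automorphism of the colored tree, and, since the
  coloring is proper and the tree connected, it is the identity as soon as it fixes one vertex.
  For every automorphism \<open>g\<close> of a finite tree, \<open>g \<circ> g\<close> fixes a vertex: otherwise take a
  shortest walk among all walks from a vertex \<open>x\<close> to \<open>g x\<close> and concatenate its translates
  under the powers of \<open>g\<close>; the resulting infinite walk never turns back, which is impossible in a
  finite tree. Hence a nontrivial \<open>g\<close> in the centralizer is an involution without fixed points,
  and a labelling of the vertices by \<open>\<plusminus>1, \<dots>, \<plusminus>m\<close> that turns \<open>g\<close> into negation turns the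
  coloring group into a group of signed permutations.\<close>

section \<open>Automorphisms of finite trees\<close>

text \<open>Finiteness forces the walk to return to a vertex. Take a return after the least possible
  number \<open>d\<close> of steps: the vertices in between are distinct, \<open>d = 1\<close> would
  be a loop and \<open>d = 2\<close> a turn back, so the stretch closes up to a cycle.\<close>

lemma nonbacktracking_walk_imp_cycle:
  fixes w :: "nat \<Rightarrow> 'a"
  assumes "finite V" and simple: "simple_graph V E"
    and edge: "\<And>i. {w i, w (Suc i)} \<in> E"
    and nonback: "\<And>i. w (Suc (Suc i)) \<noteq> w i"
  shows "\<exists>vs. graph_cycle E vs"
proof -
  have "w i \<in> V" for i
    using edge[of i] simple unfolding simple_graph_def by blast
  then have "finite (range w)" by (meson \<open>finite V\<close> finite_subset image_subsetI)
  then have "\<not> inj w" using finite_imageD infinite_UNIV_nat by blast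
  then obtain a b where ab: "a < b" "w a = w b"
    by (metis linorder_inj_onI')
  define P where "P d \<longleftrightarrow> 0 < d \<and> (\<exists>i. w (i + d) = w i)" for d
  define d where "d = (LEAST d. P d)"
  have "P (b - a)" using ab by (auto simp: P_def intro!: exI[of _ a])
  then have "P d" unfolding d_def by (rule LeastI)
  then obtain i where d: "0 < d" "w (i + d) = w i" by (auto simp: P_def)
  have min: "\<not> P c" if "c < d" for c using that not_less_Least unfolding d_def by blast
  have "w (Suc i) \<noteq> w i"
    using edge[of i] simple unfolding simple_graph_def by fastforce
  then have "d \<noteq> 1" using d by auto
  moreover have "d \<noteq> 2" using d nonback[of i] by auto
  ultimately have "3 \<le> d" using d by linarith
  let ?vs = "map (\<lambda>j. w (i + j)) [0..<d]"
  have neq: "w (i + x) \<noteq> w (i + y)" if "x < y" "y < d" for x y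
  proof
    assume "w (i + x) = w (i + y)"
    then have "P (y - x)" using that by (auto simp: P_def intro!: exI[of _ "i + x"])
    then show False using min[of "y - x"] that by simp
  qed
  then have "distinct ?vs"
    by (auto simp: distinct_map intro!: linorder_inj_onI')
  moreover have "{?vs ! j, ?vs ! (Suc j mod d)} \<in> E" if "j < d" for j
  proof (cases "Suc j = d")
    \<comment> \<open>The closing edge: its far end is \<open>w (i + d)\<close>, which is the first
      vertex \<open>w i\<close> of the list.\<close>
    case True
    then show ?thesis using edge[of "i + j"] d by auto
  next
    case False
    then show ?thesis using edge[of "i + j"] that by auto
  qed
  ultimately have "graph_cycle E ?vs" using \<open>3 \<le> d\<close> by (simp add: graph_cycle_def)
  then show ?thesis by blast
qed

text \<open>Pieces of a walk keep their length, so that deleting or isolating a stretch of a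
  shortest walk gives a contradiction by counting steps.\<close>

lemma relpow_segment:
  assumes "\<And>i. i < d \<Longrightarrow> (f i, f (Suc i)) \<in> R" "a \<le> b" "b \<le> d"
  shows "(f a, f b) \<in> R ^^ (b - a)"
  unfolding relpow_fun_conv
  by (rule exI[of _ "\<lambda>i. f (a + i)"]) (use assms in auto)

lemma finite_tree_automorphism_square_fixes_vertex:
  assumes tree: "finite_tree V E" and inj: "inj_on g V"
    and edge: "\<And>u v. {u, v} \<in> E \<Longrightarrow> {g u, g v} \<in> E"
    and V: "\<And>v. v \<in> V \<Longrightarrow> g v \<in> V"
  shows "\<exists>v\<in>V. g (g v) = v"
proof (rule ccontr)
  assume "\<not> ?thesis"
  then have noswap: "\<And>v. v \<in> V \<Longrightarrow> g (g v) \<noteq> v" by blast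
  from tree have fin: "finite V" and simple: "simple_graph V E"
    and conn: "connected_graph V E" and acyc: "\<nexists>vs. graph_cycle E vs"
    by (auto simp: finite_tree_def)
  define R where "R = {(x, y). {x, y} \<in> E}"
  \<comment> \<open>The start \<open>x\<close> varies along with the length. Hence \<open>d\<close>
    is minimal over all vertices, and a shorter walk starting at a different vertex contradicts the
    choice just as well.\<close>
  define P where "P n \<longleftrightarrow> (\<exists>x\<in>V. (x, g x) \<in> R ^^ n)" for n
  define d where "d = (LEAST n. P n)"
  obtain v where "v \<in> V" using conn by (auto simp: connected_graph_def)
  then have "(v, g v) \<in> R\<^sup>*" using conn V by (simp add: connected_graph_def R_def)
  then have "\<exists>n. P n" using \<open>v \<in> V\<close> by (auto simp: P_def rtrancl_power)
  then have "P d" unfolding d_def by (rule LeastI_ex)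
  have min: "\<not> P c" if "c < d" for c using that not_less_Least unfolding d_def by blast
  from \<open>P d\<close> obtain f where f0: "f 0 \<in> V" and fd: "f d = g (f 0)"
    and f: "\<And>i. i < d \<Longrightarrow> (f i, f (Suc i)) \<in> R"
    unfolding P_def relpow_fun_conv by metis
  have segment: "(f a, f b) \<in> R ^^ (b - a)" if "a \<le> b" "b \<le> d" for a b
    by (rule relpow_segment[where d = d]) (use f that in auto)
  \<comment> \<open>For \<open>d = 0\<close> the map \<open>g\<close> would fix \<open>f 0\<close>,
    and so would its square.\<close>
  have "d > 0"
    using fd noswap[OF f0] by (cases d) auto
  have EV: "x \<in> V \<and> y \<in> V" if "{x, y} \<in> E" for x y
    using that simple by (auto simp: simple_graph_def)
  \<comment> \<open>The translates of \<open>f\<close> under the powers of \<open>g\<close>, one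
    after the other. They fit together because \<open>f d = g (f 0)\<close>, so \<open>w\<close>
    agrees with \<open>f\<close> even at the seam \<open>i = d\<close>.\<close>
  define w where "w i = (g ^^ (i div d)) (f (i mod d))" for i
  have wf: "w i = f i" if "i \<le> d" for i
    using that fd \<open>d > 0\<close> by (cases "i = d") (auto simp: w_def)
  have wd: "w (i + d) = g (w i)" for i
    using \<open>d > 0\<close> by (simp add: w_def div_add_self2)
  \<comment> \<open>Since \<open>w (i + d) = g (w i)\<close>, a property that \<open>g\<close>
    preserves has to be checked on one period only.\<close>
  have periodic_induct: "Q i"
    if "\<And>i. i < d \<Longrightarrow> Q i" "\<And>i. Q i \<Longrightarrow> Q (i + d)" for Q :: "nat \<Rightarrow> bool" and i
  proof (induction i rule: less_induct)
    case (less i)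
    show ?case
    proof (cases "i < d")
      case False
      then show ?thesis using that(2)[of "i - d"] less[of "i - d"] \<open>d > 0\<close> by simp
    qed (use that in blast)
  qed
  have wE: "{w i, w (Suc i)} \<in> E" for i
  proof (induction i rule: periodic_induct)
    case (1 i)
    then show ?case using wf[of i] wf[of "Suc i"] f[of i] by (simp add: R_def)
  next
    case (2 i)
    then show ?case using edge wd[of i] wd[of "Suc i"] by simp
  qed
  then have wV: "w i \<in> V" for i using EV by blast
  have "w (Suc (Suc i)) \<noteq> w i" for i
  proof (induction i rule: periodic_induct)
    case (1 i)
    \<comment> \<open>A turn back at \<open>Suc i\<close> lies inside the first copy of
      \<open>f\<close>, at the seam between two copies, or, for \<open>d = 1\<close>, at the seam
      between two single edges.\<close>
    consider "Suc (Suc i) \<le> d" | "Suc i = d" "d \<ge> 2" | "i = 0" "d = 1"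
      using 1 by linarith
    then show ?case
    proof cases
      case 1
      \<comment> \<open>Inside a copy: deleting the two steps there and back leaves a walk of length
        \<open>d - 2\<close> from \<open>f 0\<close> to \<open>g (f 0)\<close>.\<close>
      show ?thesis
      proof
        assume "w (Suc (Suc i)) = w i"
        then have "f (Suc (Suc i)) = f i" using wf 1 by simp
        then have "(f 0, f d) \<in> R ^^ (i - 0 + (d - Suc (Suc i)))"
          using segment[of 0 i] segment[of "Suc (Suc i)" d] 1
          unfolding relpow_add by auto
        then have "P (i - 0 + (d - Suc (Suc i)))" using f0 fd by (auto simp: P_def)
        then show False using min 1 by auto
      qed
    next
      case 2
      \<comment> \<open>At the seam \<open>i = d - 1\<close>, and turning back means
        \<open>g (f 1) = f i\<close>. Dropping the first and the last step of \<open>f\<close> then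
        leaves a walk of length \<open>d - 2\<close> from \<open>f 1\<close> to
        \<open>g (f 1)\<close>.\<close>
      have w1: "w 1 = f 1" "f 1 \<in> V" using wf[of 1] wV[of 1] 2 by auto
      show ?thesis
      proof
        assume "w (Suc (Suc i)) = w i"
        then have "g (f 1) = f i" using wf[of i] wd[of 1] w1 2 by simp
        moreover have "1 \<le> i" "i \<le> d" "i - 1 < d" using 2 by linarith+
        ultimately have "P (i - 1)"
          using segment[of 1 i] w1(2) unfolding P_def by metis
        then show False using min[OF \<open>i - 1 < d\<close>] by blast
      qed
    next
      \<comment> \<open>Here \<open>w 2 = g (g (w 0))\<close>, so turning back is exactly what
        \<open>noswap\<close> excludes.\<close>
      case 3
      then show ?thesis using wd[of 0] wd[of 1] noswap[OF wV[of 0]] by simp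
    qed
  next
    case (2 i)
    then show ?case
      using wd[of i] wd[of "Suc (Suc i)"] inj wV[of i] wV[of "Suc (Suc i)"]
      by (auto dest: inj_onD)
  qed
  then show False
    using nonbacktracking_walk_imp_cycle[of V E w] fin simple wE acyc by blast
qed

section \<open>Bijections of a set and the centralizer\<close>

lemma mult_BijGroup_apply:
  assumes "g \<in> carrier (BijGroup S)" "h \<in> carrier (BijGroup S)" "x \<in> S"
  shows "(g \<otimes>\<^bsub>BijGroup S\<^esub> h) x = g (h x)"
  using assms by (simp add: BijGroup_def compose_eq)

lemma BijGroup_ext:
  assumes "g \<in> carrier (BijGroup S)" "h \<in> carrier (BijGroup S)" "\<And>x. x \<in> S \<Longrightarrow> g x = h x"
  shows "g = h"
  by (rule extensionalityI[of _ S])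
    (use assms in \<open>auto simp: BijGroup_def dest: Bij_imp_extensional\<close>)

lemma BijGroup_bij_betw: "g \<in> carrier (BijGroup S) \<Longrightarrow> bij_betw g S S"
  by (simp add: BijGroup_def Bij_def)

lemma restrict_in_BijGroup: "bij_betw g S S \<Longrightarrow> restrict g S \<in> carrier (BijGroup S)"
  by (simp add: BijGroup_def Bij_def)

text \<open>Serves twice: the square of a centralizing element centralizes again, and the signed
  permutations, seen as the centralizer of negation, form a subgroup.\<close>

lemma (in group) subgroup_centralizer:
  assumes H: "H \<subseteq> carrier G"
  shows "subgroup (centralizer G H) G"
proof (rule subgroupI)
  show "centralizer G H \<noteq> {}"
    using H by (auto simp: centralizer_def intro!: exI[of _ \<one>])
next
  fix a assume "a \<in> centralizer G H"
  then have a: "a \<in> carrier G" "\<And>h. h \<in> H \<Longrightarrow> a \<otimes> h = h \<otimes> a"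
    by (auto simp: centralizer_def)
  have "inv a \<otimes> h = h \<otimes> inv a" if "h \<in> H" for h
  proof -
    have "h \<in> carrier G" using that H by blast
    then have "inv a \<otimes> h = inv a \<otimes> (h \<otimes> a) \<otimes> inv a" using a by (simp add: m_assoc)
    also have "\<dots> = h \<otimes> inv a"
      using a(1) \<open>h \<in> carrier G\<close> by (simp flip: a(2)[OF that] m_assoc)
    finally show ?thesis .
  qed
  then show "inv a \<in> centralizer G H" using a by (simp add: centralizer_def)
next
  fix a b assume "a \<in> centralizer G H" "b \<in> centralizer G H"
  then have ab: "a \<in> carrier G" "b \<in> carrier G"
    "\<And>h. h \<in> H \<Longrightarrow> a \<otimes> h = h \<otimes> a" "\<And>h. h \<in> H \<Longrightarrow> b \<otimes> h = h \<otimes> b"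
    by (auto simp: centralizer_def)
  have "a \<otimes> b \<otimes> h = h \<otimes> (a \<otimes> b)" if "h \<in> H" for h
  proof -
    have "h \<in> carrier G" using that H by blast
    then show ?thesis using ab that by (metis m_assoc)
  qed
  then show "a \<otimes> b \<in> centralizer G H" using ab by (simp add: centralizer_def)
qed (auto simp: centralizer_def)

text \<open>Relabelling the points by \<phi> conjugates permutations, and conjugation by the inverse
  labelling undoes this. The restriction to \<open>S\<close> keeps the values extensional.\<close>

lemma bij_betw_imp_BijGroup_iso:
  assumes \<phi>: "bij_betw \<phi> V S"
  shows "(\<lambda>h. restrict (\<lambda>s. \<phi> (h (inv_into V \<phi> s))) S) \<in> iso (BijGroup V) (BijGroup S)"
    (is "?\<Phi> \<in> _")
proof -
  interpret GV: group "BijGroup V" by (rule group_BijGroup)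
  interpret GS: group "BijGroup S" by (rule group_BijGroup)
  define \<psi> where "\<psi> = inv_into V \<phi>"
  have \<psi>: "bij_betw \<psi> S V" unfolding \<psi>_def by (rule bij_betw_inv_into[OF \<phi>])
  have \<psi>\<phi>: "\<psi> (\<phi> v) = v" if "v \<in> V" for v
    using that \<phi> by (simp add: \<psi>_def bij_betw_inv_into_left)
  have \<phi>\<psi>: "\<phi> (\<psi> s) = s" if "s \<in> S" for s
    using that \<phi> by (simp add: \<psi>_def bij_betw_inv_into_right)
  have \<phi>S: "\<phi> v \<in> S" if "v \<in> V" for v using that \<phi> by (rule bij_betwE[THEN bspec, rotated])
  have \<psi>V: "\<psi> s \<in> V" if "s \<in> S" for s using that \<psi> by (rule bij_betwE[THEN bspec, rotated])
  have hV: "h v \<in> V" if "h \<in> carrier (BijGroup V)" "v \<in> V" for h v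
    using that BijGroup_bij_betw[of h V] by (meson bij_betwE)
  have hS: "h v \<in> S" if "h \<in> carrier (BijGroup S)" "v \<in> S" for h v
    using that BijGroup_bij_betw[of h S] by (meson bij_betwE)
  have "bij_betw (\<lambda>s. \<phi> (h (\<psi> s))) S S" if "h \<in> carrier (BijGroup V)" for h
    using bij_betw_trans[OF bij_betw_trans[OF \<psi> BijGroup_bij_betw[OF that]] \<phi>]
    by (simp add: comp_def)
  then have carr: "?\<Phi> h \<in> carrier (BijGroup S)" if "h \<in> carrier (BijGroup V)" for h
    using that unfolding \<psi>_def[symmetric] by (rule_tac restrict_in_BijGroup) blast
  have "?\<Phi> \<in> hom (BijGroup V) (BijGroup S)"
  proof (rule homI)
    fix g h assume gh: "g \<in> carrier (BijGroup V)" "h \<in> carrier (BijGroup V)"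
    show "?\<Phi> (g \<otimes>\<^bsub>BijGroup V\<^esub> h) = ?\<Phi> g \<otimes>\<^bsub>BijGroup S\<^esub> ?\<Phi> h"
    proof (rule BijGroup_ext)
      fix s assume "s \<in> S"
      then show "?\<Phi> (g \<otimes>\<^bsub>BijGroup V\<^esub> h) s = (?\<Phi> g \<otimes>\<^bsub>BijGroup S\<^esub> ?\<Phi> h) s"
        unfolding mult_BijGroup_apply[OF carr[OF gh(1)] carr[OF gh(2)] \<open>s \<in> S\<close>]
        using gh by (simp add: mult_BijGroup_apply hV \<phi>S \<psi>V \<psi>\<phi> flip: \<psi>_def)
    qed (use carr gh in auto)
  qed (use carr in auto)
  moreover have "bij_betw ?\<Phi> (carrier (BijGroup V)) (carrier (BijGroup S))"
  proof (rule bij_betw_byWitness[where f' = "\<lambda>h. restrict (\<lambda>v. \<psi> (h (\<phi> v))) V"])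
    have inv_carr: "restrict (\<lambda>v. \<psi> (h (\<phi> v))) V \<in> carrier (BijGroup V)"
      if "h \<in> carrier (BijGroup S)" for h
      using bij_betw_trans[OF bij_betw_trans[OF \<phi> BijGroup_bij_betw[OF that]] \<psi>]
      by (intro restrict_in_BijGroup) (simp add: comp_def)
    then show "(\<lambda>h. restrict (\<lambda>v. \<psi> (h (\<phi> v))) V) ` carrier (BijGroup S) \<subseteq> carrier (BijGroup V)"
      by blast
    show "\<forall>h\<in>carrier (BijGroup V). restrict (\<lambda>v. \<psi> (?\<Phi> h (\<phi> v))) V = h"
    proof
      fix h assume h: "h \<in> carrier (BijGroup V)"
      show "restrict (\<lambda>v. \<psi> (?\<Phi> h (\<phi> v))) V = h"
        by (rule BijGroup_ext[OF inv_carr[OF carr[OF h]] h])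
          (simp add: \<psi>\<phi> \<phi>S hV[OF h] flip: \<psi>_def)
    qed
    show "\<forall>h\<in>carrier (BijGroup S). ?\<Phi> (restrict (\<lambda>v. \<psi> (h (\<phi> v))) V) = h"
    proof
      fix h assume h: "h \<in> carrier (BijGroup S)"
      show "?\<Phi> (restrict (\<lambda>v. \<psi> (h (\<phi> v))) V) = h"
        by (rule BijGroup_ext[OF carr[OF inv_carr[OF h]] h])
          (simp add: \<phi>\<psi> \<psi>V hS[OF h] flip: \<psi>_def)
    qed
  qed (use carr in auto)
  ultimately show ?thesis by (simp add: iso_def)
qed

section \<open>Involutions without fixed points\<close>

text \<open>The orbits are pairs \<open>{v, g v}\<close>. Choose one vertex from each pair, number
  the chosen ones from 1 to \<open>m\<close>, and give each partner the opposite number.\<close>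

lemma fixed_point_free_involution_labelling:
  assumes "finite V" and V: "\<And>v. v \<in> V \<Longrightarrow> g v \<in> V"
    and invol: "\<And>v. v \<in> V \<Longrightarrow> g (g v) = v" and free: "\<And>v. v \<in> V \<Longrightarrow> g v \<noteq> v"
  obtains m :: nat and \<phi> :: "'a \<Rightarrow> int"
  where "card V = 2 * m" "bij_betw \<phi> V ({- int m..int m} - {0})"
    "\<And>v. v \<in> V \<Longrightarrow> \<phi> (g v) = - \<phi> v"
proof -
  \<comment> \<open>The type of the vertices has no order; an arbitrary injection into the naturals
    decides which vertex of each pair belongs to \<open>T\<close>.\<close>
  obtain n :: "'a \<Rightarrow> nat" where n: "inj_on n V"
    using \<open>finite V\<close> finite_imp_inj_to_nat_seg by meson
  define T where "T = {v \<in> V. n v < n (g v)}"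
  have T: "T \<subseteq> V" "finite T" using \<open>finite V\<close> by (auto simp: T_def)
  have gT: "g v \<in> T \<longleftrightarrow> v \<notin> T" if "v \<in> V" for v
  proof -
    have "n v \<noteq> n (g v)" using inj_onD[OF n _ that V[OF that]] free[OF that] by metis
    then show ?thesis using that V invol by (auto simp: T_def)
  qed
  have injg: "inj_on g V" by (metis inj_onI invol)
  have union: "V = T \<union> g ` T"
    using T gT V invol by (auto, metis imageI)
  have "T \<inter> g ` T = {}" using gT T by auto
  define m where "m = card T"
  have "card (g ` T) = m"
    unfolding m_def using card_image[OF inj_on_subset[OF injg T(1)]] .
  then have card: "card V = 2 * m"
    using card_Un_disjoint[OF T(2) _ \<open>T \<inter> g ` T = {}\<close>] T(2) union m_def by simp
  obtain b where b: "bij_betw b T {1..m}"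
    using T(2) m_def by (metis finite_same_card_bij card_atLeastAtMost diff_Suc_1 finite_atLeastAtMost)
  define \<phi> where "\<phi> v = (if v \<in> T then int (b v) else - int (b (g v)))" for v
  have bT: "1 \<le> b v \<and> b v \<le> m" if "v \<in> T" for v
    using bij_betwE[OF b] that by fastforce
  have binj: "u = v" if "b u = b v" "u \<in> T" "v \<in> T" for u v
    using b that by (auto simp: bij_betw_def dest: inj_onD)
  have neg: "\<phi> (g v) = - \<phi> v" if "v \<in> V" for v
    using gT[OF that] invol[OF that] by (auto simp: \<phi>_def)
  have mem: "\<phi> v \<in> {- int m..int m} - {0}" if "v \<in> V" for v
    using bT[of v] bT[of "g v"] gT[OF that] by (auto simp: \<phi>_def)
  \<comment> \<open>The sign of a label tells the two halves apart, so injectivity of \<phi> reduces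
    to that of \<open>b\<close> on \<open>T\<close>.\<close>
  have sgn: "0 < \<phi> v \<longleftrightarrow> v \<in> T" if "v \<in> V" for v
    using bT[of v] bT[of "g v"] gT[OF that] by (auto simp: \<phi>_def)
  have "inj_on \<phi> V"
  proof (rule inj_onI)
    fix u v assume uv: "u \<in> V" "v \<in> V" "\<phi> u = \<phi> v"
    then have "u \<in> T \<longleftrightarrow> v \<in> T" using sgn by metis
    show "u = v"
    proof (cases "u \<in> T")
      case True
      then show ?thesis using \<open>u \<in> T \<longleftrightarrow> v \<in> T\<close> uv binj by (simp add: \<phi>_def)
    next
      case False
      then have "g u = g v"
        using \<open>u \<in> T \<longleftrightarrow> v \<in> T\<close> uv gT by (intro binj) (simp_all add: \<phi>_def)
      then show ?thesis using injg uv by (auto dest: inj_onD)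
    qed
  qed
  \<comment> \<open>Surjectivity by counting: both sets have \<open>2 * m\<close> elements.\<close>
  moreover have "\<phi> ` V = {- int m..int m} - {0}"
  proof (rule card_subset_eq)
    show "\<phi> ` V \<subseteq> {- int m..int m} - {0}" by (rule image_subsetI) (rule mem)
    show "card (\<phi> ` V) = card ({- int m..int m} - {0})"
      using card by (simp add: card_image[OF \<open>inj_on \<phi> V\<close>])
  qed simp
  ultimately show thesis using that card neg by (simp add: bij_betw_def)
qed

text \<open>The equation \<open>p (- i) = - p i\<close> says pointwise that \<open>p\<close>
  commutes with negation. In this form, commuting with \<open>g\<close> becomes membership in the
  signed permutations once \<open>g\<close> is relabelled as negation.\<close>

lemma signed_perm_group_eq_centralizer:
  "signed_perm_group m =
    (let S = {- int m..int m} - {0}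
     in (BijGroup S)\<lparr>carrier := centralizer (BijGroup S) {restrict uminus S}\<rparr>)"
proof -
  define S where "S = {- int m..int m} - {0}"
  have "bij_betw uminus S S"
    by (rule bij_betw_byWitness[of _ uminus]) (auto simp: S_def)
  then have u: "restrict uminus S \<in> carrier (BijGroup S)" by (rule restrict_in_BijGroup)
  have neg: "- i \<in> S" if "i \<in> S" for i using that by (auto simp: S_def)
  interpret GS: group "BijGroup S" by (rule group_BijGroup)
  have "p \<otimes>\<^bsub>BijGroup S\<^esub> restrict uminus S = restrict uminus S \<otimes>\<^bsub>BijGroup S\<^esub> p \<longleftrightarrow>
      (\<forall>i\<in>S. p (- i) = - p i)" (is "?l = ?r \<longleftrightarrow> _") if p: "p \<in> carrier (BijGroup S)" for p
  proof -
    have pS: "p i \<in> S" if "i \<in> S" for i using BijGroup_bij_betw[OF p] that by (meson bij_betwE)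
    have "?l = ?r \<longleftrightarrow> (\<forall>i\<in>S. ?l i = ?r i)"
      using BijGroup_ext[of ?l S ?r] p u by (metis GS.m_closed)
    also have "\<dots> \<longleftrightarrow> (\<forall>i\<in>S. p (- i) = - p i)"
      using pS by (simp add: mult_BijGroup_apply[OF p u] mult_BijGroup_apply[OF u p])
    finally show ?thesis .
  qed
  then have "centralizer (BijGroup S) {restrict uminus S} =
      {p \<in> carrier (BijGroup S). \<forall>i\<in>S. p (- i) = - p i}"
    by (auto simp: centralizer_def)
  then show ?thesis by (simp add: signed_perm_group_def flip: S_def)
qed

section \<open>The centralizer of the coloring group\<close>

context
  fixes V :: "'a set" and E :: "'a set set" and k :: nat and \<kappa> :: "'a set \<Rightarrow> nat"
  assumes tree: "finite_tree V E" and coloring: "proper_edge_coloring E k \<kappa>"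
begin

lemma color_perm_carrier: "color_perm V E \<kappa> a \<in> carrier (BijGroup V)"
  using color_perm_in_BijGroup tree coloring by (auto simp: finite_tree_def)

lemma subgroup_coloring_group: "subgroup (coloring_group V E k \<kappa>) (BijGroup V)"
  unfolding coloring_group_def
  by (rule group.generate_is_subgroup[OF group_BijGroup]) (use color_perm_carrier in auto)

lemma color_in_range: "e \<in> E \<Longrightarrow> \<kappa> e \<in> {1..k}"
  using coloring unfolding proper_edge_coloring_def by blast

lemma edge_in_V: "{u, v} \<in> E \<Longrightarrow> u \<in> V \<and> v \<in> V"
  using tree unfolding finite_tree_def simple_graph_def by blast

lemma color_perm_edge': "{u, v} \<in> E \<Longrightarrow> color_perm V E \<kappa> (\<kappa> {u, v}) u = v"
  using color_perm_edge[of V E k \<kappa> u v] tree coloring by (auto simp: finite_tree_def)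

lemma centralizer_commutes_color_perm:
  assumes g: "g \<in> centralizer (BijGroup V) (coloring_group V E k \<kappa>)" and a: "a \<in> {1..k}"
    and u: "u \<in> V"
  shows "g (color_perm V E \<kappa> a u) = color_perm V E \<kappa> a (g u)"
proof -
  have "color_perm V E \<kappa> a \<in> coloring_group V E k \<kappa>"
    unfolding coloring_group_def by (rule generate.incl) (use a in blast)
  then have "g \<otimes>\<^bsub>BijGroup V\<^esub> color_perm V E \<kappa> a = color_perm V E \<kappa> a \<otimes>\<^bsub>BijGroup V\<^esub> g"
    using g by (simp add: centralizer_def)
  then have "(g \<otimes>\<^bsub>BijGroup V\<^esub> color_perm V E \<kappa> a) u = (color_perm V E \<kappa> a \<otimes>\<^bsub>BijGroup V\<^esub> g) u"
    by simp
  then show ?thesis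
    using g u color_perm_carrier by (simp add: mult_BijGroup_apply centralizer_def)
qed

text \<open>With \<tau> the permutation of the color of the edge, \<open>g v = \<tau> (g u)\<close>
  differs from \<open>g u\<close>. A color permutation moves a vertex only along an edge of its
  color, so such an edge joins \<open>g u\<close> to \<open>g v\<close>.\<close>

lemma centralizer_preserves_edges:
  assumes g: "g \<in> centralizer (BijGroup V) (coloring_group V E k \<kappa>)" and e: "{u, v} \<in> E"
  shows "{g u, g v} \<in> E"
proof -
  define \<tau> where "\<tau> = color_perm V E \<kappa> (\<kappa> {u, v})"
  have uv: "u \<in> V" "v \<in> V" using edge_in_V[OF e] by auto
  have bij: "bij_betw g V V" using g by (simp add: centralizer_def BijGroup_bij_betw)
  have "u \<noteq> v" using e tree by (auto simp: finite_tree_def simple_graph_def)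
  then have "g u \<noteq> g v" using bij uv by (auto simp: bij_betw_def dest: inj_onD)
  have gv: "g v = \<tau> (g u)"
    using centralizer_commutes_color_perm[OF g color_in_range[OF e] uv(1)] color_perm_edge'[OF e]
    by (simp add: \<tau>_def)
  have "g u \<in> V" using bij uv by (meson bij_betwE)
  then obtain w where w: "{g u, w} \<in> E" "\<kappa> {g u, w} = \<kappa> {u, v}"
    using color_perm_fixed[of V E k \<kappa> "g u" "\<kappa> {u, v}"] tree coloring gv \<open>g u \<noteq> g v\<close>
    by (auto simp: finite_tree_def \<tau>_def)
  then have "w = g v" using color_perm_edge'[OF w(1)] gv by (simp add: \<tau>_def)
  then show ?thesis using w by simp
qed

text \<open>Being fixed spreads along edges: if \<open>g y = y\<close> and \<tau> belongs to the
  color of \<open>{y, z}\<close>, then \<open>g z = g (\<tau> y) = \<tau> (g y) = z\<close>.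
  Connectedness carries this to every vertex.\<close>

lemma centralizer_fixed_point_imp_one:
  assumes g: "g \<in> centralizer (BijGroup V) (coloring_group V E k \<kappa>)"
    and v: "v \<in> V" "g v = v"
  shows "g = \<one>\<^bsub>BijGroup V\<^esub>"
proof (rule BijGroup_ext)
  interpret group "BijGroup V" by (rule group_BijGroup)
  show "g \<in> carrier (BijGroup V)" "\<one>\<^bsub>BijGroup V\<^esub> \<in> carrier (BijGroup V)"
    using g by (auto simp: centralizer_def)
  fix x assume "x \<in> V"
  then have "(v, x) \<in> {(x, y). {x, y} \<in> E}\<^sup>*"
    using tree v by (auto simp: finite_tree_def connected_graph_def)
  then have "g x = x"
  proof (induction rule: rtrancl_induct)
    case (step y z)
    then have e: "{y, z} \<in> E" by simp
    then have "y \<in> V" using edge_in_V by blast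
    then show ?case
      using centralizer_commutes_color_perm[OF g color_in_range[OF e]] color_perm_edge'[OF e] step.IH
      by metis
  qed (use v in simp)
  then show "g x = \<one>\<^bsub>BijGroup V\<^esub> x" using \<open>x \<in> V\<close> by (simp add: BijGroup_def)
qed

lemma coloring_group_embeds_signed_perm_group:
  assumes g: "g \<in> centralizer (BijGroup V) (coloring_group V E k \<kappa>)"
    and ne: "g \<noteq> \<one>\<^bsub>BijGroup V\<^esub>"
  obtains m H where "card V = 2 * m" "subgroup H (signed_perm_group m)"
    "(BijGroup V)\<lparr>carrier := coloring_group V E k \<kappa>\<rparr> \<cong> (signed_perm_group m)\<lparr>carrier := H\<rparr>"
proof -
  interpret GV: group "BijGroup V" by (rule group_BijGroup)
  let ?K = "coloring_group V E k \<kappa>"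
  have K: "?K \<subseteq> carrier (BijGroup V)"
    using subgroup_coloring_group by (rule subgroup.subset)
  have gc: "g \<in> carrier (BijGroup V)" using g by (simp add: centralizer_def)
  note bij = BijGroup_bij_betw[OF gc]
  have gV: "g v \<in> V" if "v \<in> V" for v using that bij by (meson bij_betwE)
  \<comment> \<open>The square of \<open>g\<close> centralizes and, by the result on tree
    automorphisms, fixes a vertex; hence it is the identity.\<close>
  have "g \<otimes>\<^bsub>BijGroup V\<^esub> g \<in> centralizer (BijGroup V) ?K"
    using GV.subgroup_centralizer[OF K] g by (simp add: subgroup.m_closed)
  moreover obtain v where "v \<in> V" "g (g v) = v"
    using finite_tree_automorphism_square_fixes_vertex[OF tree bij_betw_imp_inj_on[OF bij]
        centralizer_preserves_edges[OF g] gV] by blast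
  ultimately have "g \<otimes>\<^bsub>BijGroup V\<^esub> g = \<one>\<^bsub>BijGroup V\<^esub>"
    using centralizer_fixed_point_imp_one gc by (metis mult_BijGroup_apply)
  then have invol: "g (g x) = x" if "x \<in> V" for x
    using mult_BijGroup_apply[OF gc gc that] that by (simp add: BijGroup_def)
  have free: "g x \<noteq> x" if "x \<in> V" for x
    using centralizer_fixed_point_imp_one[OF g that] ne by blast
  have "finite V" using tree by (simp add: finite_tree_def)
  then obtain m \<phi> where m: "card V = 2 * m" and \<phi>: "bij_betw \<phi> V ({- int m..int m} - {0})"
    and neg: "\<And>v. v \<in> V \<Longrightarrow> \<phi> (g v) = - \<phi> v"
    using fixed_point_free_involution_labelling[of V g] gV invol free by metis
  define S where "S = {- int m..int m} - {0}"
  define \<Phi> where "\<Phi> h = restrict (\<lambda>s. \<phi> (h (inv_into V \<phi> s))) S" for h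
  interpret GS: group "BijGroup S" by (rule group_BijGroup)
  have iso: "\<Phi> \<in> iso (BijGroup V) (BijGroup S)"
    unfolding \<Phi>_def using bij_betw_imp_BijGroup_iso \<phi> unfolding S_def by blast
  then have hom: "\<Phi> \<in> hom (BijGroup V) (BijGroup S)"
    and inj: "inj_on \<Phi> (carrier (BijGroup V))"
    by (auto simp: iso_def bij_betw_def)
  interpret \<Phi>: group_hom "BijGroup V" "BijGroup S" \<Phi>
    by unfold_locales (rule hom)
  \<comment> \<open>Conjugation by the labelling turns \<open>g\<close> into negation, so the image
    of the coloring group commutes with negation. This image is the required
    \<open>H\<close>.\<close>
  have "\<Phi> g = restrict uminus S"
    unfolding \<Phi>_def
  proof (rule restrict_ext)
    fix s assume "s \<in> S"
    then have "inv_into V \<phi> s \<in> V" "\<phi> (inv_into V \<phi> s) = s"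
      using \<phi> by (auto simp: S_def bij_betw_def inv_into_into f_inv_into_f)
    then show "\<phi> (g (inv_into V \<phi> s)) = - s" using neg by simp
  qed
  moreover have "\<Phi> h \<otimes>\<^bsub>BijGroup S\<^esub> \<Phi> g = \<Phi> g \<otimes>\<^bsub>BijGroup S\<^esub> \<Phi> h" if "h \<in> ?K" for h
  proof -
    have "h \<in> carrier (BijGroup V)" "g \<otimes>\<^bsub>BijGroup V\<^esub> h = h \<otimes>\<^bsub>BijGroup V\<^esub> g"
      using g that K by (auto simp: centralizer_def)
    then show ?thesis using gc by (metis \<Phi>.hom_mult)
  qed
  ultimately have sub: "\<Phi> ` ?K \<subseteq> centralizer (BijGroup S) {restrict uminus S}"
    using K by (auto simp: centralizer_def)
  have signed: "signed_perm_group m =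
      (BijGroup S)\<lparr>carrier := centralizer (BijGroup S) {restrict uminus S}\<rparr>"
    by (simp add: signed_perm_group_eq_centralizer S_def Let_def)
  have "restrict uminus S \<in> carrier (BijGroup S)"
    using \<open>\<Phi> g = restrict uminus S\<close> gc \<Phi>.hom_closed by metis
  then have "subgroup (centralizer (BijGroup S) {restrict uminus S}) (BijGroup S)"
    by (intro GS.subgroup_centralizer) simp
  then have "subgroup (\<Phi> ` ?K) (signed_perm_group m)"
    unfolding signed
    using GS.subgroup_incl[OF \<Phi>.subgroup_img_is_subgroup[OF subgroup_coloring_group] _ sub]
    by blast
  moreover have "\<Phi> \<in> iso ((BijGroup V)\<lparr>carrier := ?K\<rparr>)
      ((signed_perm_group m)\<lparr>carrier := \<Phi> ` ?K\<rparr>)"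
    unfolding signed iso_def
    using inj_on_subset[OF inj K] \<Phi>.hom_mult[OF K[THEN subsetD] K[THEN subsetD]]
    by (auto simp: hom_def bij_betw_def)
  ultimately show thesis using that m by (auto simp: is_iso_def)
qed

end

theorem theorem3p11:
  fixes V :: "'a set" and E :: "'a set set" and k :: nat and \<kappa> :: "'a set \<Rightarrow> nat"
  assumes "finite_tree V E"
    and "proper_edge_coloring E k \<kappa>"
  shows "centralizer (BijGroup V) (coloring_group V E k \<kappa>) = {\<one>\<^bsub>BijGroup V\<^esub>} \<or>
    (\<exists>m. card V = 2 * m \<and>
      (\<exists>H. subgroup H (signed_perm_group m) \<and>
        (BijGroup V)\<lparr>carrier := coloring_group V E k \<kappa>\<rparr>
          \<cong> (signed_perm_group m)\<lparr>carrier := H\<rparr>))"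
proof (cases "centralizer (BijGroup V) (coloring_group V E k \<kappa>) = {\<one>\<^bsub>BijGroup V\<^esub>}")
  case False
  \<comment> \<open>A centralizer other than the trivial one still contains the identity, hence also
    a second element.\<close>
  have "\<one>\<^bsub>BijGroup V\<^esub> \<in> centralizer (BijGroup V) (coloring_group V E k \<kappa>)"
    using group.subgroup_centralizer[OF group_BijGroup
        subgroup.subset[OF subgroup_coloring_group[OF assms]]]
    by (rule subgroup.one_closed)
  with False obtain g where
    "g \<in> centralizer (BijGroup V) (coloring_group V E k \<kappa>)" "g \<noteq> \<one>\<^bsub>BijGroup V\<^esub>"
    by blast
  then show ?thesis
    using coloring_group_embeds_signed_perm_group[OF assms] by metis
qed simp

end
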